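(* The family of regular simple graphs which can be expressed as $\mathrm{DA}(X,S)$, for some closed, self-inverse subset $S\subseteq\mathrm{Der}(X)$, contains all of the following: (a) every finite regular simple graph of even valency; (b) every finite regular simple graph of odd valency that has a perfect matching; (c) every finite vertex-transitive simple graph, and every finite regular bipartite simple graph.
   Context: For a set $X$, $\mathrm{Sym}(X)$ is the group of all permutations of $X$, acting on the right: $x^s$ is the image of $x$ under $s$, and $x^{st}=(x^s)^t$. A derangement of $X$ is a permutation of $X$ with no fixed points; $\mathrm{Der}(X)$ is the set of derangements of $X$. For $A,B\subseteq\mathrm{Sym}(X)$, $AB=\{ab : a\in A,b\in B\}$ and $A^{-1}=\{a^{-1}: a\in A\}$; for $x\in X$, $x^A=\{x^a: a\in A\}$; $1$ denotes the identity permutation. A subset $S$ is self-inverse if $S=S^{-1}$. A non-empty subset $S\subseteq\mathrm{Der}(X)$, with $X$ non-empty, is closed if both (1) $x^S=x^{S^{-1}}$ for each $x\in X$, and (2) $SS^{-1}\subseteq\mathrm{Der}(X)\cup\{1\}$. A simple digraph is a pair $(X,A)$ with vertex set $X$ and arc set $A\subseteq\{(u,v): u,v\in X, u\neq v\}$. It is a simple graph if $A$ is symmetric: $(x,y)\in A$ implies $(y,x)\in A$; it is then identified with the undirected graph whose edges are the pairs $\{(x,y),(y,x)\}\subseteq A$. It is regular of valency $k$ if every vertex has exactly $k$ out-neighbours and exactly $k$ in-neighbours. A perfect matching in a finite simple graph $(X,A)$ is a subgraph $(X,A')$, with $A'\subseteq A$ symmetric, each of whose connected components is a single edge (two vertices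 $u,v$ with arc set $\{(u,v),(v,u)\}$). A graph is vertex-transitive if its automorphism group is transitive on its vertices. For non-empty $X$ and non-empty $S\subseteq \mathrm{Der}(X)$, the derangement action digraph is the simple digraph with vertex set $X$ and arc set $\{(x,x^s): x\in X, s\in S\}$; when it is a simple graph it is denoted $\mathrm{DA}(X,S)$.
   Formalization: The graph is assumed to have at least one edge: edgeless graphs (valency 0, hence even, vertex-transitive and bipartite) are never of the form DA(X,S), since X and S must be non-empty and derangements fix no point. *)

theory Defs
  imports
    "Graph_Theory.Digraph_Component"
    "HOL-Combinatorics.Permutations"
begin

section \<open>Sets of permutations\<close>

text \<open>
  A permutation of \<open>X\<close> is a function \<open>s\<close> on the ambient type with \<open>s permutes X\<close>; in particular
  \<open>s\<close> is the identity outside \<open>X\<close>, so the identity permutation of \<open>X\<close> is \<open>id\<close> and the inverse of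
  \<open>s\<close> is \<open>inv s\<close>.  The image \<open>x\<^sup>s\<close> is \<open>s x\<close>.
\<close>

definition derangements :: "'a set \<Rightarrow> ('a \<Rightarrow> 'a) set" where
  "derangements X = {s. s permutes X \<and> (\<forall>x\<in>X. s x \<noteq> x)}"

text \<open>Permutations act on the right: the product \<open>ab\<close> applies \<open>a\<close> first.\<close>

definition perm_set_mult :: "('a \<Rightarrow> 'a) set \<Rightarrow> ('a \<Rightarrow> 'a) set \<Rightarrow> ('a \<Rightarrow> 'a) set" where
  "perm_set_mult A B = {b \<circ> a | a b. a \<in> A \<and> b \<in> B}"

definition perm_set_inv :: "('a \<Rightarrow> 'a) set \<Rightarrow> ('a \<Rightarrow> 'a) set" where
  "perm_set_inv A = {inv a | a. a \<in> A}"

definition point_image :: "'a \<Rightarrow> ('a \<Rightarrow> 'a) set \<Rightarrow> 'a set" where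
  "point_image x A = {a x | a. a \<in> A}"

definition self_inverse :: "('a \<Rightarrow> 'a) set \<Rightarrow> bool" where
  "self_inverse S \<longleftrightarrow> S = perm_set_inv S"

definition closed_derangements :: "'a set \<Rightarrow> ('a \<Rightarrow> 'a) set \<Rightarrow> bool" where
  "closed_derangements X S \<longleftrightarrow>
     X \<noteq> {} \<and> S \<noteq> {} \<and> S \<subseteq> derangements X \<and>
     (\<forall>x\<in>X. point_image x S = point_image x (perm_set_inv S)) \<and>
     perm_set_mult S (perm_set_inv S) \<subseteq> derangements X \<union> {id}"


section \<open>Simple graphs\<close>

text \<open>
  A simple digraph \<open>(X, A)\<close> is a \<^typ>\<open>'a pair_pre_digraph\<close> satisfying
  \<^locale>\<open>pair_loopfree_digraph\<close>; it is a simple graph if it satisfies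
  \<^locale>\<open>pair_bidirected_digraph\<close>, and a finite simple graph if it satisfies \<^locale>\<open>pair_graph\<close>.
\<close>

text \<open>
  The finiteness conditions matter for infinite graphs only, where \<^const>\<open>out_degree\<close> and
  \<^const>\<open>in_degree\<close> are \<open>0\<close> at vertices of infinite degree.
\<close>

definition regular_of_valency :: "'a pair_pre_digraph \<Rightarrow> nat \<Rightarrow> bool" where
  "regular_of_valency G k \<longleftrightarrow>
     (\<forall>v \<in> pverts G.
        finite (out_arcs (with_proj G) v) \<and> out_degree (with_proj G) v = k \<and>
        finite (in_arcs (with_proj G) v) \<and> in_degree (with_proj G) v = k)"

definition is_single_edge :: "('a, 'a \<times> 'a) pre_digraph \<Rightarrow> bool" where
  "is_single_edge C \<longleftrightarrow>
     (\<exists>u v. u \<noteq> v \<and> verts C = {u, v} \<and> arcs C = {(u, v), (v, u)})"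

text \<open>
  The connected components of a symmetric digraph are its strongly connected components
  \<^const>\<open>pre_digraph.sccs\<close>.
\<close>

definition is_perfect_matching :: "'a pair_pre_digraph \<Rightarrow> 'a pair_pre_digraph \<Rightarrow> bool" where
  "is_perfect_matching M G \<longleftrightarrow>
     spanning (with_proj M) (with_proj G) \<and> pair_sym_digraph M \<and>
     (\<forall>C \<in> pre_digraph.sccs (with_proj M). is_single_edge C)"

definition graph_automorphisms :: "'a pair_pre_digraph \<Rightarrow> ('a \<Rightarrow> 'a) set" where
  "graph_automorphisms G =
     {p. p permutes pverts G \<and>
         (\<forall>x\<in>pverts G. \<forall>y\<in>pverts G. (x, y) \<in> parcs G \<longleftrightarrow> (p x, p y) \<in> parcs G)}"

definition vertex_transitive :: "'a pair_pre_digraph \<Rightarrow> bool" where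
  "vertex_transitive G \<longleftrightarrow>
     (\<forall>x\<in>pverts G. \<forall>y\<in>pverts G. \<exists>p\<in>graph_automorphisms G. p x = y)"

definition bipartite :: "'a pair_pre_digraph \<Rightarrow> bool" where
  "bipartite G \<longleftrightarrow>
     (\<exists>U V. pverts G = U \<union> V \<and> U \<inter> V = {} \<and> parcs G \<subseteq> U \<times> V \<union> V \<times> U)"


section \<open>Derangement action graphs\<close>

definition derangement_action_digraph :: "'a set \<Rightarrow> ('a \<Rightarrow> 'a) set \<Rightarrow> 'a pair_pre_digraph" where
  "derangement_action_digraph X S = \<lparr> pverts = X, parcs = {(x, s x) | x s. x \<in> X \<and> s \<in> S} \<rparr>"

text \<open>
  Since \<^const>\<open>closed_derangements\<close> demands a non-empty vertex set and a non-empty set of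
  derangements, every graph in this family has at least one arc.
\<close>

definition derangement_action_family :: "'a pair_pre_digraph set" where
  "derangement_action_family =
     {G. pair_bidirected_digraph G \<and> (\<exists>k. regular_of_valency G k) \<and>
         (\<exists>S. closed_derangements (pverts G) S \<and> self_inverse S \<and>
              G = derangement_action_digraph (pverts G) S)}"

end

theory Submission
  imports Defs "HOL-Combinatorics.Cycles"
begin

text \<open>
  A closed, self-inverse set \<open>S\<close> with \<open>G = DA(X, S)\<close> is a decomposition of the arcs of \<open>G\<close> into
  graphs of permutations that is invariant under inversion.  In even valency \<open>2r\<close>, orient \<open>G\<close> so
  that all in- and out-degrees are \<open>r\<close>; by Hall's theorem the orientation splits into \<open>r\<close>
  permutations, and these together with their inverses form \<open>S\<close>.  In odd valency, add the
  involution given by a perfect matching to a set \<open>S\<close> for the remaining graph.  A regular bipartite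
  graph has a perfect matching by Hall's theorem.  In a vertex-transitive graph without a perfect
  matching every vertex is missed by some maximum matching, so by Gallai's lemma a maximum matching
  misses at most one vertex of each component; then some component has odd order, which is
  impossible in odd valency.
\<close>

section \<open>Pairs of involutions\<close>

lemma involution_permutes:
  assumes "\<And>x. f (f x) = x" and "\<And>x. x \<notin> S \<Longrightarrow> f x = x"
  shows "f permutes S"
  unfolding permutes_def using assms by metis

locale involution_pair =
  fixes f g :: "'a \<Rightarrow> 'a" and S :: "'a set"
  assumes finite: "finite S"
    and f_inv: "f (f x) = x" and g_inv: "g (g x) = x"
    and f_id: "x \<notin> S \<Longrightarrow> f x = x" and g_id: "x \<notin> S \<Longrightarrow> g x = x"
begin

text \<open>The rotation in the dihedral group generated by the two reflections \<open>f\<close> and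
  \<open>g\<close>.\<close>

definition rot :: "'a \<Rightarrow> 'a" where
  "rot = f \<circ> g"

text \<open>Natural exponents suffice: \<open>rot\<close> has finite order, so this is its full
  orbit.\<close>

definition cyc :: "'a \<Rightarrow> 'a set" where
  "cyc x = range (\<lambda>n. (rot ^^ n) x)"

lemma f_rot [simp]: "f (rot x) = g x"
  by (simp add: rot_def f_inv)

lemma rot_g [simp]: "rot (g x) = f x"
  by (simp add: rot_def g_inv)

lemma rot_permutes: "rot permutes S"
  unfolding rot_def
  by (intro permutes_compose involution_permutes) (simp_all add: f_inv g_inv f_id g_id)

lemma rot_pow_eq_iff [simp]: "(rot ^^ n) x = (rot ^^ n) y \<longleftrightarrow> x = y"
  using permutes_inj[OF permutes_funpow[OF rot_permutes]] by (metis injD)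

text \<open>The dihedral relation: \<open>f\<close> conjugates \<open>rot\<close> to its inverse.
  The induction rests on \<open>rot (f (rot y)) = rot (g y) = f y\<close>.\<close>

lemma rot_pow_f: "(rot ^^ n) (f ((rot ^^ n) x)) = f x"
proof (induction n arbitrary: x)
  case (Suc n)
  have "(rot ^^ Suc n) (f ((rot ^^ Suc n) x)) = (rot ^^ n) (rot (f (rot ((rot ^^ n) x))))"
    by (simp add: funpow_swap1)
  then show ?case
    using Suc by simp
qed simp

lemma rot_nilpotent: obtains N where "N > 0" "rot ^^ N = id"
  using permutation_is_nilpotent[OF permutes_imp_permutation[OF finite rot_permutes]] by blast

lemma rot_pow_inverse: obtains m where "\<And>x. (rot ^^ m) ((rot ^^ n) x) = x"
proof -
  obtain N where N: "N > 0" "rot ^^ N = id"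
    using rot_nilpotent .
  \<comment> \<open>As \<open>rot ^^ N = id\<close>, the exponent \<open>(N - 1) * n\<close> stands
    in for \<open>- n\<close>.\<close>
  have "(rot ^^ ((N - 1) * n)) ((rot ^^ n) x) = x" for x
  proof -
    have "(N - 1) * n + n = N * n"
      using N(1) by (simp add: algebra_simps)
    then have "(rot ^^ ((N - 1) * n)) ((rot ^^ n) x) = (rot ^^ (N * n)) x"
      by (metis comp_apply funpow_add)
    also have "\<dots> = x"
      by (metis N(2) funpow_mult id_apply id_funpow)
    finally show ?thesis .
  qed
  then show ?thesis
    using that by blast
qed

lemma self_in_cyc [simp]: "x \<in> cyc x"
  unfolding cyc_def by (metis funpow_0 rangeI)

lemma rot_in_cyc: "rot x \<in> cyc x"
  unfolding cyc_def using rangeI[of "\<lambda>n. (rot ^^ n) x" 1] by simp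

lemma cyc_eq:
  assumes "y \<in> cyc x"
  shows "cyc y = cyc x"
proof -
  have sub: "cyc z \<subseteq> cyc w" if zw: "z \<in> cyc w" for z w
  proof -
    obtain n where "z = (rot ^^ n) w"
      using zw by (auto simp: cyc_def)
    then have "(rot ^^ k) z = (rot ^^ (k + n)) w" for k
      by (simp add: funpow_add)
    then show ?thesis
      unfolding cyc_def by auto
  qed
  obtain n where n: "y = (rot ^^ n) x"
    using assms by (auto simp: cyc_def)
  obtain m where "\<And>x. (rot ^^ m) ((rot ^^ n) x) = x"
    using rot_pow_inverse by blast
  then have "x \<in> cyc y"
    unfolding cyc_def n by (metis rangeI)
  then show ?thesis
    using sub assms by blast
qed

lemma cyc_f:
  assumes "y \<in> cyc x"
  shows "f y \<in> cyc (f x)"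
proof -
  obtain n where n: "y = (rot ^^ n) x"
    using assms by (auto simp: cyc_def)
  obtain m where "\<And>x. (rot ^^ m) ((rot ^^ n) x) = x"
    using rot_pow_inverse by blast
  then have "f y = (rot ^^ m) (f x)"
    by (metis n rot_pow_f)
  then show ?thesis
    by (simp add: cyc_def)
qed

lemma cyc_g:
  assumes "y \<in> cyc x"
  shows "g y \<in> cyc (f x)"
proof -
  have "f (rot y) \<in> cyc (f x)"
    using rot_in_cyc cyc_f assms cyc_eq by blast
  then show ?thesis
    by simp
qed

text \<open>A reflection that keeps a rotation orbit has a midpoint: if \<open>f x\<close> is
  \<open>n\<close> steps from \<open>x\<close>, then \<open>f\<close> fixes the point halfway for
  even \<open>n\<close>, and \<open>g\<close> fixes the last point before the middle for odd
  \<open>n\<close>.\<close>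

lemma f_notin_cyc:
  assumes f_free: "\<And>y. y \<in> S \<Longrightarrow> f y \<noteq> y" and g_free: "\<And>y. y \<in> S \<Longrightarrow> g y \<noteq> y"
    and "x \<in> S"
  shows "f x \<notin> cyc x"
proof
  assume "f x \<in> cyc x"
  then obtain n where n: "f x = (rot ^^ n) x"
    by (auto simp: cyc_def)
  have in_S: "(rot ^^ k) x \<in> S" for k
    using permutes_funpow[OF rot_permutes] \<open>x \<in> S\<close> by (simp add: permutes_in_image)
  show False
  proof (cases "even n")
    case True
    then obtain j where "n = j + j"
      by (metis evenE mult_2)
    then have "(rot ^^ j) ((rot ^^ j) x) = (rot ^^ j) (f ((rot ^^ j) x))"
      using n rot_pow_f by (simp add: funpow_add)
    then show False
      using f_free in_S by (metis rot_pow_eq_iff)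
  next
    case False
    then obtain j where "n = j + Suc j"
      by (metis oddE mult_2 add_Suc_right Suc_eq_plus1)
    then have "(rot ^^ j) (rot ((rot ^^ j) x)) = (rot ^^ j) (f ((rot ^^ j) x))"
      using n rot_pow_f by (simp add: funpow_add funpow_swap1)
    then have "rot ((rot ^^ j) x) = f ((rot ^^ j) x)"
      by simp
    then have "g ((rot ^^ j) x) = (rot ^^ j) x"
      by (metis f_rot f_inv)
    then show False
      using g_free in_S by blast
  qed
qed

text \<open>If neither involution has a fixed point on \<open>S\<close>, the orbits of the group they generate are
  even cycles, each made of two orbits of \<open>rot\<close> that both involutions exchange.\<close>

lemma alternating_colouring:
  assumes "\<And>y. y \<in> S \<Longrightarrow> f y \<noteq> y" and "\<And>y. y \<in> S \<Longrightarrow> g y \<noteq> y"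
  obtains T where "\<And>x. x \<in> S \<Longrightarrow> f x \<in> T \<longleftrightarrow> x \<notin> T" and "\<And>x. x \<in> S \<Longrightarrow> g x \<in> T \<longleftrightarrow> x \<notin> T"
proof
  \<comment> \<open>The choice is made from the unordered pair of orbits, so \<open>x\<close> and
    \<open>f x\<close> consult the same choice; as the two orbits differ, exactly one of them is
    coloured.\<close>
  define T where "T = {x. cyc x = (SOME C. C \<in> {cyc x, cyc (f x)})}"
  have swap: "y \<in> T \<longleftrightarrow> x \<notin> T" if "x \<in> S" "cyc y = cyc (f x)" "cyc (f y) = cyc x" for x y
  proof -
    have "(SOME C. C \<in> {cyc x, cyc (f x)}) \<in> {cyc x, cyc (f x)}"
      by (rule someI[of _ "cyc x"]) simp
    moreover have "cyc x \<noteq> cyc (f x)"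
      using f_notin_cyc[OF assms \<open>x \<in> S\<close>] self_in_cyc by metis
    ultimately show ?thesis
      unfolding T_def mem_Collect_eq that(2,3) insert_commute[of "cyc (f x)" "cyc x"] by auto
  qed
  show "f x \<in> T \<longleftrightarrow> x \<notin> T" if "x \<in> S" for x
    using swap[OF that] by (simp add: f_inv)
  show "g x \<in> T \<longleftrightarrow> x \<notin> T" if "x \<in> S" for x
  proof (rule swap[OF that])
    show "cyc (g x) = cyc (f x)"
      using cyc_g cyc_eq self_in_cyc by blast
    then have "f (g x) \<in> cyc (f (f x))"
      using cyc_f self_in_cyc by metis
    then show "cyc (f (g x)) = cyc x"
      using cyc_eq f_inv by metis
  qed
qed

text \<open>From \<open>g t = t\<close> follows \<open>rot t = f t\<close>, so the two
  \<open>rot\<close>-orbits that \<open>f\<close> exchanges coincide and form the whole orbit under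
  both involutions.\<close>

lemma cyc_fixed_closed:
  assumes "g t = t"
  shows "f y \<in> cyc t \<longleftrightarrow> y \<in> cyc t" and "g y \<in> cyc t \<longleftrightarrow> y \<in> cyc t"
proof -
  have "f t \<in> cyc t"
    using rot_in_cyc[of t] assms by (simp add: rot_def)
  then have "cyc (f t) = cyc t"
    by (rule cyc_eq)
  then show "f y \<in> cyc t \<longleftrightarrow> y \<in> cyc t" "g y \<in> cyc t \<longleftrightarrow> y \<in> cyc t"
    using cyc_f cyc_g f_inv g_inv by metis+
qed

lemma funpow_mult_fixed: "(rot ^^ d) x = x \<Longrightarrow> (rot ^^ (m * d)) x = x"
  by (induction m) (simp_all add: funpow_add)

text \<open>The orbit of \<open>t\<close> under both involutions is a path, and \<open>t\<close> is one of its two ends.\<close>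

lemma cyc_fixed_unique:
  assumes "g t = t" and "f u = u" and "f v = v" and "u \<in> cyc t" and "v \<in> cyc t"
  shows "u = v"
proof -
  have rt: "rot t = f t"
    using assms(1) by (simp add: rot_def)
  have *: "(rot ^^ a) t = (rot ^^ b) t"
    if "a \<le> b" "f ((rot ^^ a) t) = (rot ^^ a) t" "f ((rot ^^ b) t) = (rot ^^ b) t" for a b
  proof -
    define d where "d = b - a"
    have b: "b = a + d"
      using that(1) by (simp add: d_def)
    \<comment> \<open>The dihedral relation turns a point fixed by \<open>f\<close> after
      \<open>k\<close> steps into \<open>(rot ^^ (2 * k)) t = f t\<close>.\<close>
    have dbl: "(rot ^^ (k + k)) t = rot t" if "f ((rot ^^ k) t) = (rot ^^ k) t" for k
      using rot_pow_f[of k t] that rt by (simp add: funpow_add)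
    have "(rot ^^ (a + a)) ((rot ^^ (d + d)) t) = (rot ^^ (b + b)) t"
    proof -
      have "(a + a) + (d + d) = b + b"
        by (simp add: b)
      then show ?thesis
        by (metis comp_apply funpow_add)
    qed
    also have "\<dots> = (rot ^^ (a + a)) t"
      using dbl that(2,3) by simp
    finally have even_period: "(rot ^^ (2 * d)) t = t"
      by (simp add: mult_2)
    \<comment> \<open>Both \<open>2 * d\<close> and the odd number \<open>2 * a - 1\<close> are
      periods of \<open>t\<close>, and \<open>d * (2 * a - 1)\<close> is \<open>d\<close> plus a
      multiple of \<open>2 * d\<close>, so \<open>d\<close> is a period too. For
      \<open>a = 0\<close> the subtraction would truncate; there \<open>1\<close> is a
      period.\<close>
    have "(rot ^^ d) t = t"
    proof (cases a)
      case 0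
      then have "rot t = t"
        using dbl[OF that(2)] by simp
      then have "(rot ^^ 1) t = t"
        by simp
      from funpow_mult_fixed[OF this, of d] show ?thesis
        by simp
    next
      case (Suc c)
      have "rot ((rot ^^ (c + Suc c)) t) = rot t"
        using dbl[OF that(2)] Suc by simp
      then have "(rot ^^ (c + Suc c)) t = t"
        by (metis permutes_inj[OF rot_permutes] injD)
      moreover have "d * (c + Suc c) = d + c * (2 * d)"
        by (simp add: algebra_simps)
      ultimately have "(rot ^^ (d + c * (2 * d))) t = t"
        by (metis funpow_mult_fixed)
      then show ?thesis
        using funpow_mult_fixed[OF even_period, of c] by (simp only: funpow_add comp_apply)
    qed
    then show ?thesis
      by (simp add: b funpow_add)
  qed
  obtain a b where "u = (rot ^^ a) t" "v = (rot ^^ b) t"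
    using assms(4,5) by (auto simp: cyc_def)
  then show ?thesis
    using *[of a b] *[of b a] assms(2,3) by (cases "a \<le> b") auto
qed

end


section \<open>Balanced orientations\<close>

lemma even_card_involution:
  assumes "finite B" and "even (card B)"
  shows "\<exists>p. \<forall>y\<in>B. p y \<in> B \<and> p (p y) = y \<and> p y \<noteq> y"
proof -
  obtain r where "card B = 2 * r"
    using assms(2) by blast
  with assms(1) show ?thesis
  proof (induction r arbitrary: B)
    case (Suc r)
    obtain a where a: "a \<in> B"
      using Suc.prems by fastforce
    have "card (B - {a}) = Suc (2 * r)"
      using Suc.prems a by simp
    then obtain b where b: "b \<in> B - {a}"
      by (metis card.empty ex_in_conv nat.distinct(1))
    have "card (B - {a, b}) = 2 * r"
      using Suc.prems a b by (auto simp: card_Diff_subset)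
    then obtain p where p: "\<forall>y\<in>B - {a, b}. p y \<in> B - {a, b} \<and> p (p y) = y \<and> p y \<noteq> y"
      using Suc.IH[of "B - {a, b}"] Suc.prems(1) by auto
    have "\<forall>y\<in>B. (p(a := b, b := a)) y \<in> B \<and> (p(a := b, b := a)) ((p(a := b, b := a)) y) = y
        \<and> (p(a := b, b := a)) y \<noteq> y"
      using a b p by auto
    then show ?case
      by blast
  qed auto
qed

text \<open>Pair up the arcs leaving each vertex.  This pairing and arc reversal are involutions on the
  arcs without fixed points, so the arcs can be coloured with two colours which both of them
  exchange; one of the colour classes is the orientation.\<close>

lemma balanced_orientation:
  assumes fin: "finite A" and "sym A" and "irrefl A" and ev: "\<And>x. even (card (A `` {x}))"
  obtains D where "A = D \<union> D\<inverse>" and "D \<inter> D\<inverse> = {}"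
    and "\<And>x. 2 * card (D `` {x}) = card (A `` {x})" and "\<And>x. 2 * card (D\<inverse> `` {x}) = card (A `` {x})"
proof -
  have finx: "finite (A `` {x})" for x
    using fin by (rule finite_Image)
  obtain p where "\<forall>x. \<forall>y\<in>A `` {x}. p x y \<in> A `` {x} \<and> p x (p x y) = y \<and> p x y \<noteq> y"
    using even_card_involution[OF finx ev] by metis
  then have p: "(x, p x y) \<in> A" "p x (p x y) = y" "p x y \<noteq> y" if "(x, y) \<in> A" for x y
    using that by auto
  \<comment> \<open>\<open>f\<close> keeps the tail of an arc and replaces its head by the partner
    under \<open>p\<close>; both maps are the identity off \<open>A\<close>, as the locale
    demands.\<close>
  define f where "f = (\<lambda>e. if e \<in> A then (fst e, p (fst e) (snd e)) else e)"
  define g where "g = (\<lambda>e. if e \<in> A then prod.swap e else e)"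
  interpret involution_pair f g A
  proof
    show "f (f e) = e" for e
    proof (cases "e \<in> A")
      case True
      then have "(fst e, p (fst e) (snd e)) \<in> A" "p (fst e) (p (fst e) (snd e)) = snd e"
        using p(1,2)[of "fst e" "snd e"] by simp_all
      then show ?thesis
        using True by (simp add: f_def)
    qed (simp add: f_def)
    show "g (g e) = e" for e
      using \<open>sym A\<close> by (cases e) (simp add: g_def sym_def)
  qed (auto simp: f_def g_def fin)
  have free: "f e \<noteq> e" "g e \<noteq> e" if "e \<in> A" for e
    using that p(3)[of "fst e" "snd e"] \<open>irrefl A\<close>
    by (cases e; auto simp: f_def g_def irrefl_def)+
  obtain T where T: "\<And>e. e \<in> A \<Longrightarrow> f e \<in> T \<longleftrightarrow> e \<notin> T" "\<And>e. e \<in> A \<Longrightarrow> g e \<in> T \<longleftrightarrow> e \<notin> T"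
    using alternating_colouring free by metis
  define D where "D = A \<inter> T"
  have D: "(x, p x y) \<in> T \<longleftrightarrow> (x, y) \<notin> T" "(y, x) \<in> T \<longleftrightarrow> (x, y) \<notin> T" if "(x, y) \<in> A" for x y
    using T[OF that] that by (simp_all add: f_def g_def)
  have sym_A: "(y, x) \<in> A" if "(x, y) \<in> A" for x y
    using \<open>sym A\<close> that by (rule symD)
  have D_out: "y \<in> D `` {x} \<longleftrightarrow> (x, y) \<in> A \<and> (x, y) \<in> T"
    and D_in: "y \<in> D\<inverse> `` {x} \<longleftrightarrow> (x, y) \<in> A \<and> (x, y) \<notin> T" for x y
    using D(2)[of x y] sym_A by (auto simp: D_def)
  have split: "A `` {x} = D `` {x} \<union> D\<inverse> `` {x}" "D `` {x} \<inter> D\<inverse> `` {x} = {}" for x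
    using D_out D_in by blast+
  \<comment> \<open>A neighbour \<open>y\<close> of \<open>x\<close> is on the outgoing or the
    incoming side according to the colour of \<open>(x, y)\<close>. Pairing flips this colour, so
    \<open>p x\<close> matches the two sides.\<close>
  have "bij_betw (p x) (D `` {x}) (D\<inverse> `` {x})" for x
  proof (rule bij_betw_byWitness[where f' = "p x"])
    show "p x ` (D `` {x}) \<subseteq> D\<inverse> `` {x}" "p x ` (D\<inverse> `` {x}) \<subseteq> D `` {x}"
      using D_out D_in p(1) D(1) by (metis image_subsetI)+
  qed (use D_out D_in p(2) in blast)+
  then have eq: "card (D `` {x}) = card (D\<inverse> `` {x})" for x
    by (rule bij_betw_same_card)
  have "card (A `` {x}) = card (D `` {x}) + card (D\<inverse> `` {x})" for x
    unfolding split(1) using finx split by (metis card_Un_disjoint finite_Un)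
  then show ?thesis
  proof (intro that[of D])
    show "A = D \<union> D\<inverse>" "D \<inter> D\<inverse> = {}"
      using split by auto
  qed (use eq in simp_all)
qed


section \<open>Decomposing regular relations into permutations\<close>

text \<open>Rado's proof: a set with two elements can lose one of them without violating the condition.\<close>

lemma hall_marriage:
  assumes "finite I" and "\<And>i. i \<in> I \<Longrightarrow> finite (F i)"
    and "\<And>J. J \<subseteq> I \<Longrightarrow> card J \<le> card (\<Union>(F ` J))"
  shows "\<exists>s. inj_on s I \<and> (\<forall>i\<in>I. s i \<in> F i)"
  using assms(2,3)
proof (induction "\<Sum>i\<in>I. card (F i)" arbitrary: F rule: less_induct)
  case less
  show ?case
  proof (cases "\<exists>i\<in>I. card (F i) \<ge> 2")
    case False
    have "card (F i) = 1" if "i \<in> I" for i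
      using less.prems(2)[of "{i}"] False that by force
    then have "\<forall>i\<in>I. \<exists>y. F i = {y}"
      using card_1_singletonE by metis
    then obtain s where s: "\<And>i. i \<in> I \<Longrightarrow> F i = {s i}"
      by metis
    have "inj_on s I"
    proof (rule inj_onI, rule ccontr)
      fix i j assume "i \<in> I" "j \<in> I" "s i = s j" "i \<noteq> j"
      then show False
        using less.prems(2)[of "{i, j}"] s by auto
    qed
    then show ?thesis
      using s by auto
  next
    case True
    then obtain i where i: "i \<in> I" "card (F i) \<ge> 2"
      by blast
    have step: ?thesis
      if "x \<in> F i" "\<And>J. J \<subseteq> I \<Longrightarrow> card J \<le> card (\<Union>((F(i := F i - {x})) ` J))" for x
    proof -
      have "(\<Sum>j\<in>I. card ((F(i := F i - {x})) j)) < (\<Sum>j\<in>I. card (F j))"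
      proof (rule sum_strict_mono_ex1[OF \<open>finite I\<close>])
        show "\<exists>j\<in>I. card ((F(i := F i - {x})) j) < card (F j)"
          using i(1) that(1) less.prems(1) by (intro bexI[of _ i]) (auto intro!: psubset_card_mono simp del: card_Diff_insert card_Diff_singleton)
      qed (use less.prems(1) that(1) in \<open>auto intro: card_mono\<close>)
      then have "\<exists>s. inj_on s I \<and> (\<forall>j\<in>I. s j \<in> (F(i := F i - {x})) j)"
        using less.prems(1) that(2) by (intro less.hyps) auto
      then show ?thesis
        using i(1) by (metis DiffD1 fun_upd_apply)
    qed
    \<comment> \<open>A violating set contains \<open>i\<close>, since the other sets are unchanged.
      Taking \<open>i\<close> out lowers its size by one, which turns the strict inequality into
      \<open>\<le>\<close>.\<close>
    have bad: "\<exists>J. J \<subseteq> I \<and> i \<notin> J \<and> card (\<Union>(F ` J) \<union> (F i - {x})) \<le> card J"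
      if "J \<subseteq> I" "\<not> card J \<le> card (\<Union>((F(i := F i - {x})) ` J))" for x J
    proof -
      have "i \<in> J"
      proof (rule ccontr)
        assume "i \<notin> J"
        then have "(F(i := F i - {x})) ` J = F ` J"
          by auto
        then show False
          using less.prems(2)[OF that(1)] that(2) by simp
      qed
      then have "\<Union>((F(i := F i - {x})) ` J) = \<Union>(F ` (J - {i})) \<union> (F i - {x})"
        by (auto split: if_splits)
      moreover have "card J = Suc (card (J - {i}))"
        using \<open>i \<in> J\<close> that(1) \<open>finite I\<close> by (metis card.remove finite_subset)
      ultimately show ?thesis
        using that by (intro exI[of _ "J - {i}"]) (simp add: not_le less_Suc_eq_le Diff_subset[THEN subset_trans])
    qed
    have "\<not> card (F i) \<le> Suc 0"
      using i(2) by simp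
    then obtain x y where xy: "x \<in> F i" "y \<in> F i" "x \<noteq> y"
      using card_le_Suc0_iff_eq[OF less.prems(1)[OF i(1)]] by blast
    show ?thesis
    proof (rule ccontr)
      assume neg: "\<not> ?thesis"
      obtain J where J: "J \<subseteq> I" "i \<notin> J" "card (\<Union>(F ` J) \<union> (F i - {x})) \<le> card J"
        using step[OF xy(1)] neg bad[where x = x] by metis
      obtain K where K: "K \<subseteq> I" "i \<notin> K" "card (\<Union>(F ` K) \<union> (F i - {y})) \<le> card K"
        using step[OF xy(2)] neg bad[where x = y] by metis
      let ?U = "\<Union>(F ` J) \<union> (F i - {x})" and ?V = "\<Union>(F ` K) \<union> (F i - {y})"
      have finJK: "finite J" "finite K"
        using J(1) K(1) \<open>finite I\<close> finite_subset by blast+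
      have fin: "finite ?U" "finite ?V"
        using J(1) K(1) finJK less.prems(1) i(1) by auto
      \<comment> \<open>As \<open>x \<noteq> y\<close>, the two reduced copies of \<open>F i\<close>
        together cover it. So \<open>?U \<union> ?V\<close> contains the union over
        \<open>insert i (J \<union> K)\<close>, and \<open>?U \<inter> ?V\<close> the union over
        \<open>J \<inter> K\<close>; the extra index \<open>i\<close> makes the count
        contradictory.\<close>
      have "card J + card K + 1 = card (insert i (J \<union> K)) + card (J \<inter> K)"
        using card_Un_Int[OF finJK] finJK J(2) K(2) by simp
      also have "\<dots> \<le> card (\<Union>(F ` insert i (J \<union> K))) + card (\<Union>(F ` (J \<inter> K)))"
        using J(1) K(1) i(1) by (intro add_mono less.prems(2)) auto
      also have "\<dots> \<le> card (?U \<union> ?V) + card (?U \<inter> ?V)"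
        using fin xy by (intro add_mono card_mono) auto
      also have "\<dots> = card ?U + card ?V"
        using card_Un_Int[OF fin] by simp
      finally show False
        using J(3) K(3) by simp
    qed
  qed
qed

text \<open>Double counting gives Hall's condition: \<open>r * card J\<close> pairs leave
  \<open>J\<close>, and each point of its image receives at most \<open>r\<close> of them. The
  representatives form an injective self-map of a finite set, hence a permutation.\<close>

lemma regular_relation_permutation:
  assumes "finite X" and "D \<subseteq> X \<times> X" and "r > 0"
    and out: "\<And>x. x \<in> X \<Longrightarrow> card (D `` {x}) = r" and "in": "\<And>x. x \<in> X \<Longrightarrow> card (D\<inverse> `` {x}) = r"
  obtains s where "s permutes X" and "\<And>x. x \<in> X \<Longrightarrow> (x, s x) \<in> D"
proof -
  have finD: "finite D"
    using assms(1,2) by (meson finite_SigmaI finite_subset)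
  then have finx: "finite (D `` {x})" "finite (D\<inverse> `` {x})" for x
    by (simp_all add: finite_Image)
  have hall: "card J \<le> card (\<Union>x\<in>J. D `` {x})" if "J \<subseteq> X" for J
  proof -
    let ?N = "\<Union>x\<in>J. D `` {x}"
    have "?N \<subseteq> X"
      using assms(2) by blast
    then have N: "?N \<subseteq> X" "finite ?N" "finite J"
      using assms(1) that finite_subset by blast+
    have "r * card J = (\<Sum>x\<in>J. card (D `` {x}))"
      using out that by (simp add: subset_iff)
    also have "\<dots> = card (Sigma J (\<lambda>x. D `` {x}))"
      using N finx by simp
    also have "\<dots> \<le> card (prod.swap ` Sigma ?N (\<lambda>y. D\<inverse> `` {y}))"
      using N finx by (intro card_mono) force+
    also have "\<dots> \<le> card (Sigma ?N (\<lambda>y. D\<inverse> `` {y}))"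
      using N finx by (intro card_image_le) auto
    also have "\<dots> = (\<Sum>y\<in>?N. card (D\<inverse> `` {y}))"
      using N finx by simp
    also have "\<dots> = (\<Sum>y\<in>?N. r)"
      using N(1) "in" by (intro sum.cong) auto
    also have "\<dots> = r * card ?N"
      by simp
    finally show ?thesis
      using \<open>r > 0\<close> by simp
  qed
  obtain s where s: "inj_on s X" "\<And>x. x \<in> X \<Longrightarrow> s x \<in> D `` {x}"
    using hall_marriage[OF \<open>finite X\<close>, of "\<lambda>x. D `` {x}"] hall finx by metis
  define t where "t x = (if x \<in> X then s x else x)" for x
  have "t ` X \<subseteq> X"
    using s(2) assms(2) by (auto simp: t_def)
  moreover have "inj_on t X"
    using s(1) by (simp add: t_def inj_on_def)
  ultimately have "bij_betw t X X"
    using \<open>finite X\<close> by (simp add: bij_betw_def endo_inj_surj)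
  then have "t permutes X"
    by (rule bij_imp_permutes) (simp add: t_def)
  then show ?thesis
    using that s(2) by (simp add: t_def)
qed

text \<open>The last clause makes the graphs of distinct members disjoint over \<open>X\<close>, so
  that they partition \<open>D\<close>.\<close>

definition permutation_decomposition :: "'a set \<Rightarrow> ('a \<times> 'a) set \<Rightarrow> ('a \<Rightarrow> 'a) set \<Rightarrow> bool" where
  "permutation_decomposition X D P \<longleftrightarrow>
     (\<forall>s\<in>P. s permutes X) \<and> D = {(x, s x) | x s. x \<in> X \<and> s \<in> P} \<and>
     (\<forall>s\<in>P. \<forall>t\<in>P. \<forall>x\<in>X. s x = t x \<longrightarrow> s = t)"

text \<open>Removing one permutation inside \<open>D\<close> lowers every out- and in-degree by one,
  so permutations can be peeled off one at a time.\<close>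

lemma regular_relation_decomposition:
  assumes "finite X" and "D \<subseteq> X \<times> X"
    and "\<And>x. x \<in> X \<Longrightarrow> card (D `` {x}) = r" and "\<And>x. x \<in> X \<Longrightarrow> card (D\<inverse> `` {x}) = r"
  shows "\<exists>P. permutation_decomposition X D P"
  unfolding permutation_decomposition_def
  using assms(2-)
proof (induction r arbitrary: D)
  case 0
  have "finite (D `` {x})" for x
    using assms(1) 0(1) finite_subset finite_Image by (metis finite_SigmaI)
  then have "D = {}"
    using 0 by fastforce
  then show ?case
    by (intro exI[of _ "{}"]) auto
next
  case (Suc r)
  obtain s where s: "s permutes X" "\<And>x. x \<in> X \<Longrightarrow> (x, s x) \<in> D"
    using regular_relation_permutation[OF assms(1) Suc.prems(1) _ Suc.prems(2,3)] by blast
  define E where "E = D - {(x, s x) | x. x \<in> X}"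
  have sub: "E \<subseteq> X \<times> X"
    using Suc.prems(1) by (auto simp: E_def)
  have "E `` {x} = D `` {x} - {s x}" if "x \<in> X" for x
    using that by (auto simp: E_def)
  then have 1: "card (E `` {x}) = r" if "x \<in> X" for x
    using that s(2) Suc.prems(2)[OF that] by simp
  have "E\<inverse> `` {x} = D\<inverse> `` {x} - {inv s x}" "(inv s x, x) \<in> D" if "x \<in> X" for x
    using that s(2)[of "inv s x"] permutes_inverses[OF s(1)] permutes_in_image[OF permutes_inv[OF s(1)]]
    by (auto simp: E_def)
  then have 2: "card (E\<inverse> `` {x}) = r" if "x \<in> X" for x
    using that Suc.prems(3)[OF that] by simp
  obtain P where P: "\<forall>s\<in>P. s permutes X" "E = {(x, s x) | x s. x \<in> X \<and> s \<in> P}"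
    "\<forall>s\<in>P. \<forall>t\<in>P. \<forall>x\<in>X. s x = t x \<longrightarrow> s = t"
    by (rule exE[OF Suc.IH[OF sub 1 2]]) (assumption | elim conjE, rule that)+
  have sep: "t x \<noteq> s x" if "t \<in> P" "x \<in> X" for t x
    using that P(2) by (auto simp: E_def)
  have "D = {(x, t x) | x t. x \<in> X \<and> t \<in> insert s P}"
  proof -
    have "D = E \<union> {(x, s x) | x. x \<in> X}"
      using s(2) by (auto simp: E_def)
    then show ?thesis
      unfolding P(2) by auto
  qed
  then show ?case
    using s(1) P(1,3) sep by (intro exI[of _ "insert s P"]) (auto, metis+)
qed


section \<open>Matchings of vertex-transitive graphs\<close>

lemma even_card_if_involution:
  assumes "finite B" and "\<And>x. x \<in> B \<Longrightarrow> f x \<in> B" and "\<And>x. x \<in> B \<Longrightarrow> f (f x) = x"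
    and "\<And>x. x \<in> B \<Longrightarrow> f x \<noteq> x"
  shows "even (card B)"
  using assms
proof (induction B rule: finite_psubset_induct)
  case (psubset B)
  show ?case
  proof (cases "B = {}")
    case False
    then obtain a where a: "a \<in> B"
      by blast
    have closed: "f x \<in> B - {a, f a}" if "x \<in> B - {a, f a}" for x
      using that psubset.prems(1,2) a by (metis Diff_iff insert_iff empty_iff)
    have "even (card (B - {a, f a}))"
      using a closed psubset.prems by (intro psubset.IH) auto
    moreover have "B = insert a (insert (f a) (B - {a, f a}))"
      using a psubset.prems(1) by blast
    then have "card B = Suc (Suc (card (B - {a, f a})))"
      using psubset.hyps psubset.prems(3)[OF a]
      by (metis card_insert_disjoint finite_Diff finite_insert Diff_iff insertCI insertE)
    ultimately show ?thesis
      by simp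
  qed simp
qed

text \<open>A matching is encoded by the involution that swaps the ends of its edges and fixes the
  vertices it misses.\<close>

definition matching :: "('a \<times> 'a) set \<Rightarrow> ('a \<Rightarrow> 'a) \<Rightarrow> bool" where
  "matching A f \<longleftrightarrow> (\<forall>x. f (f x) = x) \<and> (\<forall>x. f x \<noteq> x \<longrightarrow> (x, f x) \<in> A)"

definition missed :: "'a set \<Rightarrow> ('a \<Rightarrow> 'a) \<Rightarrow> 'a set" where
  "missed X f = {x \<in> X. f x = x}"

text \<open>Fewest missed vertices amounts to most edges when \<open>X\<close> is finite and
  \<open>A \<subseteq> X \<times> X\<close>.\<close>

definition maximum_matching :: "'a set \<Rightarrow> ('a \<times> 'a) set \<Rightarrow> ('a \<Rightarrow> 'a) \<Rightarrow> bool" where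
  "maximum_matching X A f \<longleftrightarrow>
     matching A f \<and> (\<forall>g. matching A g \<longrightarrow> card (missed X f) \<le> card (missed X g))"

lemma maximum_matching_exists: obtains f where "maximum_matching X A f"
proof -
  have "matching A id"
    by (simp add: matching_def)
  then show ?thesis
    using ex_has_least_nat[of "matching A" id "\<lambda>f. card (missed X f)"] that
    unfolding maximum_matching_def by blast
qed

locale finite_symmetric_relation =
  fixes X :: "'a set" and A :: "('a \<times> 'a) set"
  assumes finite_X: "finite X" and subset: "A \<subseteq> X \<times> X" and sym: "sym A" and irrefl: "irrefl A"
begin

lemma finite_missed [simp]: "finite (missed X f)"
  using finite_X by (simp add: missed_def)

lemma arcD: "(x, y) \<in> A \<Longrightarrow> x \<in> X \<and> y \<in> X \<and> x \<noteq> y \<and> (y, x) \<in> A"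
  using subset sym irrefl by (auto simp: irrefl_def dest: symD)

text \<open>Otherwise the edge joining \<open>u\<close> and \<open>v\<close> could be added to the
  matching.\<close>

lemma maximum_matching_adjacent:
  assumes f: "maximum_matching X A f" and "(u, v) \<in> A" and "f u = u" and "f v = v"
  shows False
proof -
  have uv: "u \<in> X" "v \<in> X" "u \<noteq> v" "(v, u) \<in> A"
    using arcD[OF assms(2)] by auto
  have f': "f (f x) = x" "f x \<noteq> x \<Longrightarrow> (x, f x) \<in> A" for x
    using f by (auto simp: maximum_matching_def matching_def)
  define h where "h = f(u := v, v := u)"
  have "f x = u \<longleftrightarrow> x = u" "f x = v \<longleftrightarrow> x = v" for x
    using f'(1) assms(3,4) by metis+
  then have "h (h x) = x" for x
    using f'(1) uv(3) by (simp add: h_def)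
  moreover have "(x, h x) \<in> A" if "h x \<noteq> x" for x
    using that f'(2) assms(2) uv(3,4) by (auto simp: h_def split: if_splits)
  ultimately have "matching A h"
    by (simp add: matching_def)
  then have "card (missed X f) \<le> card (missed X h)"
    using f by (simp add: maximum_matching_def)
  moreover have "missed X h \<subset> missed X f"
    using uv assms(3,4) by (auto simp: missed_def h_def)
  then have "card (missed X h) < card (missed X f)"
    by (simp add: psubset_card_mono)
  ultimately show False
    by simp
qed

text \<open>Exchange \<open>f\<close> and \<open>g\<close> along the alternating path that starts at \<open>t\<close>: it contains at most one
  vertex missed by \<open>f\<close>.\<close>

lemma maximum_matching_switch:
  assumes f: "maximum_matching X A f" and g: "maximum_matching X A g"
    and "g t = t" and "f u = u" and "f v = v" and "u \<noteq> v"
  shows "\<exists>h. maximum_matching X A h \<and> h t = t \<and> (h u = u \<or> h v = v)"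
proof -
  have f': "f (f x) = x" "f x \<noteq> x \<Longrightarrow> (x, f x) \<in> A" for x
    using f by (auto simp: maximum_matching_def matching_def)
  have g': "g (g x) = x" "g x \<noteq> x \<Longrightarrow> (x, g x) \<in> A" for x
    using g by (auto simp: maximum_matching_def matching_def)
  interpret involution_pair f g X
    using f' g' finite_X subset by unfold_locales blast+
  define C where "C = cyc t"
  have C: "f y \<in> C \<longleftrightarrow> y \<in> C" "g y \<in> C \<longleftrightarrow> y \<in> C" for y
    unfolding C_def using cyc_fixed_closed[OF assms(3)] by blast+
  define h where "h x = (if x \<in> C then g x else f x)" for x
  \<comment> \<open>The complementary exchange. Together \<open>h\<close> and \<open>h'\<close> miss
    as many vertices as \<open>f\<close> and \<open>g\<close>, and \<open>h'\<close> misses at least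
    as many as the maximum matching \<open>g\<close>; hence \<open>h\<close> misses no more than
    \<open>f\<close>.\<close>
  define h' where "h' x = (if x \<in> C then f x else g x)" for x
  have "matching A h" "matching A h'"
    using f' g' C by (auto simp: matching_def h_def h'_def)
  moreover have "card (missed X h) \<le> card (missed X f)"
  proof -
    have split: "card (missed X k) = card (missed X k \<inter> C) + card (missed X k - C)" for k
      by (rule card_Int_Diff) simp
    have "missed X h \<inter> C = missed X g \<inter> C" "missed X h - C = missed X f - C"
      "missed X h' \<inter> C = missed X f \<inter> C" "missed X h' - C = missed X g - C"
      by (auto simp: missed_def h_def h'_def)
    then have "card (missed X h) + card (missed X h') = card (missed X f) + card (missed X g)"
      using split[of h] split[of h'] split[of f] split[of g] by simp
    moreover have "card (missed X g) \<le> card (missed X h')"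
      using g \<open>matching A h'\<close> by (simp add: maximum_matching_def)
    ultimately show ?thesis
      by simp
  qed
  ultimately have "maximum_matching X A h"
    using f unfolding maximum_matching_def by (meson order_trans)
  moreover have "h t = t"
    using assms(3) by (simp add: h_def C_def)
  moreover have "u \<notin> C \<or> v \<notin> C"
    using cyc_fixed_unique[OF assms(3-5)] assms(6) by (auto simp: C_def)
  then have "h u = u \<or> h v = v"
    using assms(4,5) by (auto simp: h_def)
  ultimately show ?thesis
    by blast
qed

text \<open>Induct along a walk whose last arc is \<open>(t, v)\<close>. Switching \<open>f\<close>
  with a maximum matching that misses \<open>t\<close> gives one that misses \<open>t\<close> and
  also \<open>u\<close> or \<open>v\<close>. It cannot miss the adjacent \<open>t\<close> and
  \<open>v\<close>, so it misses \<open>u\<close> and \<open>t\<close>, and the induction hypothesis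
  for this new matching yields \<open>u = t\<close>. Then \<open>f\<close> misses the adjacent
  \<open>u\<close> and \<open>v\<close>.\<close>

lemma gallai:
  assumes miss: "\<And>x. x \<in> X \<Longrightarrow> \<exists>g. maximum_matching X A g \<and> g x = x"
    and "(u, v) \<in> A\<^sup>*" and "maximum_matching X A f" and "f u = u" and "f v = v"
  shows "u = v"
  using assms(2-)
proof (induction arbitrary: f rule: rtrancl_induct)
  case (step t v)
  show ?case
  proof (rule ccontr)
    assume "u \<noteq> v"
    obtain g where "maximum_matching X A g" "g t = t"
      using miss arcD[OF step.hyps(2)] by blast
    then obtain h where h: "maximum_matching X A h" "h t = t" "h u = u \<or> h v = v"
      using maximum_matching_switch step.prems \<open>u \<noteq> v\<close> by metis
    then have "h u = u"
      using maximum_matching_adjacent step.hyps(2) by blast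
    then have "u = t"
      using step.IH h(1,2) by blast
    then show False
      using maximum_matching_adjacent step.hyps(2) step.prems by blast
  qed
qed simp

text \<open>Handshaking: the arcs that start in \<open>K\<close> also end there, so reversal is an
  involution without fixed points on them.\<close>

lemma even_degree_sum:
  assumes "K \<subseteq> X" and "A `` K \<subseteq> K"
  shows "even (\<Sum>x\<in>K. card (A `` {x}))"
proof -
  have fin: "finite K" "finite A"
    using assms(1) finite_X subset finite_subset by (blast, meson finite_SigmaI finite_subset)
  have "(\<Sum>x\<in>K. card (A `` {x})) = card (Sigma K (\<lambda>x. A `` {x}))"
    using fin by (simp add: finite_Image)
  moreover have "even (card (Sigma K (\<lambda>x. A `` {x})))"
  proof (rule even_card_if_involution[where f = prod.swap])
    show "finite (Sigma K (\<lambda>x. A `` {x}))"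
      using fin by (simp add: finite_Image)
  qed (use assms(2) arcD in \<open>auto dest: arcD\<close>)
  ultimately show ?thesis
    by simp
qed

lemma odd_regular_transitive_perfect_matching:
  assumes reg: "\<And>x. x \<in> X \<Longrightarrow> card (A `` {x}) = k" and "odd k"
    and trans: "\<And>x y. x \<in> X \<Longrightarrow> y \<in> X \<Longrightarrow>
      \<exists>p. p permutes X \<and> p x = y \<and> (\<forall>(a, b)\<in>A. (p a, p b) \<in> A)"
  obtains f where "matching A f" and "\<And>x. x \<in> X \<Longrightarrow> f x \<noteq> x"
proof -
  obtain f where f: "maximum_matching X A f"
    using maximum_matching_exists .
  have f': "f (f x) = x" "f x \<noteq> x \<Longrightarrow> (x, f x) \<in> A" for x
    using f by (auto simp: maximum_matching_def matching_def)
  have False if u: "u \<in> X" "f u = u" for u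
  proof -
    have miss: "\<exists>g. maximum_matching X A g \<and> g y = y" if "y \<in> X" for y
    proof -
      obtain p where p: "p permutes X" "p u = y" "\<And>a b. (a, b) \<in> A \<Longrightarrow> (p a, p b) \<in> A"
        using trans[OF u(1) \<open>y \<in> X\<close>] by auto
      \<comment> \<open>Conjugation by the automorphism \<open>p\<close> carries \<open>f\<close>,
        which misses \<open>u\<close>, to a matching that misses \<open>y = p u\<close> and no more
        vertices in total.\<close>
      define g where "g = p \<circ> f \<circ> inv p"
      have inv: "inv p (p x) = x" "p (inv p x) = x" for x
        using permutes_inverses[OF p(1)] by auto
      have "(x, g x) \<in> A" if "g x \<noteq> x" for x
      proof -
        have "f (inv p x) \<noteq> inv p x"
          using that inv by (auto simp: g_def)
        then have "(p (inv p x), p (f (inv p x))) \<in> A"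
          using p(3) f'(2) by blast
        then show ?thesis
          by (simp add: g_def inv)
      qed
      then have "matching A g"
        by (simp add: matching_def g_def inv f'(1))
      moreover have "missed X g \<subseteq> p ` missed X f"
      proof
        fix x assume x: "x \<in> missed X g"
        then have "f (inv p x) = inv p x"
          unfolding missed_def g_def using inv by (metis (mono_tags, lifting) comp_apply mem_Collect_eq)
        moreover have "inv p x \<in> X"
          using x permutes_in_image[OF permutes_inv[OF p(1)]] by (simp add: missed_def)
        ultimately show "x \<in> p ` missed X f"
          using inv(2)[of x] by (auto simp: missed_def intro!: image_eqI[of _ _ "inv p x"])
      qed
      then have "card (missed X g) \<le> card (missed X f)"
        by (meson card_image_le card_mono finite_imageI finite_missed le_trans)
      ultimately have "maximum_matching X A g"
        using f unfolding maximum_matching_def by (meson order_trans)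
      moreover have "g y = y"
        using p(2) inv(1)[of u] u(2) by (auto simp: g_def)
      ultimately show ?thesis
        by blast
    qed
    \<comment> \<open>The component of \<open>u\<close>. By Gallai's lemma \<open>f\<close> misses
      only \<open>u\<close> there and pairs off the rest, so \<open>card K\<close> is odd; for odd
      \<open>k\<close> the degree sum \<open>k * card K\<close> would be odd as well.\<close>
    define K where "K = A\<^sup>* `` {u}"
    have K: "A `` K \<subseteq> K" "u \<in> K"
      by (auto simp: K_def intro: rtrancl_into_rtrancl)
    have "K \<subseteq> X"
      using u(1) by (auto simp: K_def elim: rtranclE dest: arcD)
    then have "finite K"
      using finite_X finite_subset by blast
    have fixed: "x = u" if "x \<in> K" "f x = x" for x
      using gallai[OF miss _ f u(2) that(2)] that(1) by (auto simp: K_def)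
    have "even (card (K - {u}))"
    proof (rule even_card_if_involution)
      show "f x \<in> K - {u}" "f x \<noteq> x" if "x \<in> K - {u}" for x
        using that fixed f' K(1) u(2) by (metis DiffD1 DiffD2 DiffI Image_singleton_iff ImageI singletonI singletonD subsetD)+
    qed (use \<open>finite K\<close> f' in auto)
    moreover have "card K = Suc (card (K - {u}))"
      using \<open>finite K\<close> K(2) by (rule card.remove)
    moreover have "(\<Sum>x\<in>K. card (A `` {x})) = k * card K"
      using reg \<open>K \<subseteq> X\<close> by (simp add: subset_iff)
    ultimately show False
      using even_degree_sum[OF \<open>K \<subseteq> X\<close> K(1)] \<open>odd k\<close> by simp
  qed
  then show ?thesis
    using that f by (auto simp: maximum_matching_def)
qed

end


section \<open>Derangement action graphs\<close>

text \<open>Closure under inverses makes \<open>S\<close> its own inverse set, which settles the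
  first closedness condition. For the second, if \<open>b \<circ> a\<close> fixes a vertex, then
  \<open>a\<close> and \<open>inv b\<close> agree there, hence are equal. Members of
  \<open>S\<close> are derangements because \<open>G\<close> has no loops.\<close>

lemma derangement_action_familyI:
  assumes "pair_bidirected_digraph G" and "regular_of_valency G k" and "parcs G \<noteq> {}"
    and S: "permutation_decomposition (pverts G) (parcs G) S" and inv: "\<And>s. s \<in> S \<Longrightarrow> inv s \<in> S"
  shows "G \<in> derangement_action_family"
proof -
  have perm: "\<And>s. s \<in> S \<Longrightarrow> s permutes pverts G"
    and arcs: "parcs G = {(x, s x) | x s. x \<in> pverts G \<and> s \<in> S}"
    and sep: "\<And>s t x. s \<in> S \<Longrightarrow> t \<in> S \<Longrightarrow> x \<in> pverts G \<Longrightarrow> s x = t x \<Longrightarrow> s = t"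
    using S unfolding permutation_decomposition_def by blast+
  interpret pair_bidirected_digraph G
    by fact
  have inv_inv: "inv (inv s) = s" if "s \<in> S" for s
    using perm[OF that] by (rule permutes_inv_inv)
  have inv_set: "perm_set_inv S = S"
    unfolding perm_set_inv_def using inv inv_inv by force
  have "S \<subseteq> derangements (pverts G)"
  proof
    fix s assume s: "s \<in> S"
    have "s x \<noteq> x" if "x \<in> pverts G" for x
    proof -
      have "(x, s x) \<in> parcs G"
        using s that unfolding arcs by blast
      then show ?thesis
        using pair_no_loops by fastforce
    qed
    then show "s \<in> derangements (pverts G)"
      using perm[OF s] by (simp add: derangements_def)
  qed
  moreover have "perm_set_mult S S \<subseteq> derangements (pverts G) \<union> {id}"
  proof
    fix q assume "q \<in> perm_set_mult S S"
    then obtain a b where ab: "a \<in> S" "b \<in> S" "q = b \<circ> a"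
      by (auto simp: perm_set_mult_def)
    show "q \<in> derangements (pverts G) \<union> {id}"
    proof (cases "a = inv b")
      case True
      then show ?thesis
        using ab permutes_inv_o(1)[OF perm[OF ab(2)]] by simp
    next
      case False
      have "q x \<noteq> x" if "x \<in> pverts G" for x
        using sep[OF ab(1) inv[OF ab(2)] that] False ab(3) permutes_inverses(2)[OF perm[OF ab(2)]]
        by (metis comp_apply)
      then show ?thesis
        using permutes_compose[OF perm[OF ab(1)] perm[OF ab(2)]] ab(3)
        by (simp add: derangements_def)
    qed
  qed
  moreover have "S \<noteq> {}" "pverts G \<noteq> {}"
    using assms(3) unfolding arcs by auto
  ultimately have "closed_derangements (pverts G) S"
    by (simp add: closed_derangements_def inv_set)
  moreover have "G = derangement_action_digraph (pverts G) S"
    using arcs by (simp add: derangement_action_digraph_def)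
  ultimately show ?thesis
    using assms(1,2) inv_set unfolding derangement_action_family_def self_inverse_def by auto
qed

section \<open>Degrees and arc decompositions of finite simple graphs\<close>

lemma card_out_arcs: "card (out_arcs (with_proj G) v) = card (parcs G `` {v})"
proof -
  have "out_arcs (with_proj G) v = Pair v ` (parcs G `` {v})"
    by (auto simp: out_arcs_def)
  then show ?thesis
    by (simp add: card_image inj_on_def)
qed

lemma card_in_arcs: "card (in_arcs (with_proj G) v) = card ((parcs G)\<inverse> `` {v})"
proof -
  have "in_arcs (with_proj G) v = (\<lambda>u. (u, v)) ` ((parcs G)\<inverse> `` {v})"
    by (auto simp: in_arcs_def)
  then show ?thesis
    by (simp add: card_image inj_on_def)
qed

context
  fixes G :: "'a pair_pre_digraph"
  assumes G: "pair_graph G"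
begin

interpretation pair_graph G
  by (rule G)

lemma arcs_sym: "(parcs G)\<inverse> = parcs G"
  using sym_arcs by (auto simp: symmetric_def dest: symD)

lemma arcs_relation: "finite_symmetric_relation (pverts G) (parcs G)"
proof
  show "irrefl (parcs G)"
    using pair_no_loops by (fastforce simp: irrefl_def)
  show "sym (parcs G)"
    using arcs_sym by (simp add: sym_conv_converse_eq)
qed (use wellformed' in auto)

interpretation finite_symmetric_relation "pverts G" "parcs G"
  by (rule arcs_relation)

lemma regular_of_valency_iff:
  "regular_of_valency G k \<longleftrightarrow> (\<forall>v\<in>pverts G. card (parcs G `` {v}) = k)"
proof -
  have "finite (out_arcs (with_proj G) v)" "finite (in_arcs (with_proj G) v)" for v
    using pair_finite_arcs by (simp_all add: out_arcs_def in_arcs_def)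
  then show ?thesis
    by (auto simp: regular_of_valency_def out_degree_def in_degree_def card_out_arcs card_in_arcs
        arcs_sym)
qed

text \<open>Petersen's argument: balanced orientations are regular, hence decompose into permutations,
  and the reversed arcs then decompose into the inverse permutations.\<close>

lemma even_regular_decomposition:
  assumes A: "A \<subseteq> parcs G" "sym A" and reg: "\<And>x. x \<in> pverts G \<Longrightarrow> card (A `` {x}) = 2 * r"
  shows "\<exists>S. permutation_decomposition (pverts G) A S \<and> (\<forall>s\<in>S. inv s \<in> S)"
proof -
  let ?X = "pverts G"
  have "irrefl A" "finite A"
    using A(1) irrefl finite_subset[OF A(1) pair_finite_arcs] by (auto simp: irrefl_def)
  moreover have "even (card (A `` {x}))" for x
  proof (cases "x \<in> ?X")
    case False
    then have "A `` {x} = {}"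
      using A(1) wellformed' by blast
    then show ?thesis
      by simp
  qed (simp add: reg)
  ultimately obtain D where D: "A = D \<union> D\<inverse>" "D \<inter> D\<inverse> = {}"
    "\<And>x. 2 * card (D `` {x}) = card (A `` {x})" "\<And>x. 2 * card (D\<inverse> `` {x}) = card (A `` {x})"
    using balanced_orientation[OF _ A(2)] by metis
  have "D \<subseteq> ?X \<times> ?X"
    using D(1) A(1) subset by blast
  moreover have "card (D `` {x}) = r" "card (D\<inverse> `` {x}) = r" if "x \<in> ?X" for x
    using D(3,4)[of x] reg[OF that] by simp_all
  ultimately obtain P where "permutation_decomposition ?X D P"
    using regular_relation_decomposition[OF finite_X, of D r] by auto
  then have P: "\<And>s. s \<in> P \<Longrightarrow> s permutes ?X"
    "D = {(x, s x) | x s. x \<in> ?X \<and> s \<in> P}"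
    "\<And>s t x. s \<in> P \<Longrightarrow> t \<in> P \<Longrightarrow> x \<in> ?X \<Longrightarrow> s x = t x \<Longrightarrow> s = t"
    unfolding permutation_decomposition_def by blast+
  have perm_inv: "inv s permutes ?X" "inv (inv s) = s" "s (inv s x) = x" "inv s (s x) = x"
    if "s \<in> P" for s x
    using P(1)[OF that] permutes_inv permutes_inv_inv permutes_inverses by metis+
  have D_inv: "D\<inverse> = {(x, inv s x) | x s. x \<in> ?X \<and> s \<in> P}"
  proof (intro set_eqI iffI)
    fix e assume "e \<in> D\<inverse>"
    then obtain x s where "e = (s x, x)" "x \<in> ?X" "s \<in> P"
      unfolding P(2) by auto
    then have "e = (s x, inv s (s x))" "s x \<in> ?X" "s \<in> P"
      using perm_inv(4) permutes_in_image[OF P(1)] by auto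
    then show "e \<in> {(x, inv s x) | x s. x \<in> ?X \<and> s \<in> P}"
      by blast
  next
    fix e assume "e \<in> {(x, inv s x) | x s. x \<in> ?X \<and> s \<in> P}"
    then obtain x s where e: "e = (x, inv s x)" "x \<in> ?X" "s \<in> P"
      by blast
    then have "(inv s x, s (inv s x)) \<in> D"
      unfolding P(2) using permutes_in_image[OF perm_inv(1)] by blast
    then show "e \<in> D\<inverse>"
      using e perm_inv(3)[OF e(3), of x] by simp
  qed
  \<comment> \<open>\<open>s\<close> runs along arcs of \<open>D\<close> and \<open>inv t\<close>
    along reversed ones, and no arc is of both sorts.\<close>
  have cross: "s x \<noteq> inv t x" if "s \<in> P" "t \<in> P" "x \<in> ?X" for s t x
  proof
    assume "s x = inv t x"
    moreover have "(x, s x) \<in> D" "(x, inv t x) \<in> D\<inverse>"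
      using that P(2) D_inv by blast+
    ultimately show False
      using D(2) by auto
  qed
  \<comment> \<open>At the common value \<open>inv s x = inv t x\<close>, both \<open>s\<close> and
    \<open>t\<close> take the value \<open>x\<close>.\<close>
  have sep_inv: "s = t" if "s \<in> P" "t \<in> P" "x \<in> ?X" "inv s x = inv t x" for s t x
  proof (rule P(3))
    show "s (inv s x) = t (inv s x)"
      using perm_inv(3)[OF that(1), of x] perm_inv(3)[OF that(2), of x] that(4) by simp
    show "inv s x \<in> ?X"
      using permutes_in_image[OF perm_inv(1)[OF that(1)]] that(3) by simp
  qed fact+
  have "s permutes ?X" if "s \<in> P \<union> inv ` P" for s
    using that P(1) perm_inv(1) by auto
  moreover have "A = {(x, s x) | x s. x \<in> ?X \<and> s \<in> P \<union> inv ` P}"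
    unfolding D(1) D_inv by (subst P(2)) blast
  moreover have "s = t" if "s \<in> P \<union> inv ` P" "t \<in> P \<union> inv ` P" "x \<in> ?X" "s x = t x" for s t x
  proof -
    from that(1,2) consider "s \<in> P" "t \<in> P" | u where "s \<in> P" "t = inv u" "u \<in> P"
      | u where "s = inv u" "u \<in> P" "t \<in> P"
      | u w where "s = inv u" "u \<in> P" "t = inv w" "w \<in> P"
      by blast
    then show ?thesis
    proof cases
      case 1
      then show ?thesis
        using P(3) that(3,4) by blast
    next
      case 2
      then show ?thesis
        using cross[of s u x] that(3,4) by simp
    next
      case 3
      then show ?thesis
        using cross[of t u x] that(3,4) by simp
    next
      case 4
      then show ?thesis
        using sep_inv[of u w x] that(3,4) by simp
    qed
  qed
  ultimately have "permutation_decomposition ?X A (P \<union> inv ` P)"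
    unfolding permutation_decomposition_def by blast
  moreover have "\<forall>s\<in>P \<union> inv ` P. inv s \<in> P \<union> inv ` P"
    using perm_inv(2) by auto
  ultimately show ?thesis
    by blast
qed

section \<open>Membership in the family by parity of the valency\<close>

lemma even_regular_in_family:
  assumes "parcs G \<noteq> {}" and "regular_of_valency G k" and "even k"
  shows "G \<in> derangement_action_family"
proof -
  obtain r where "k = 2 * r"
    using assms(3) by blast
  then have "\<And>x. x \<in> pverts G \<Longrightarrow> card (parcs G `` {x}) = 2 * r"
    using assms(2) by (simp add: regular_of_valency_iff)
  then show ?thesis
    using even_regular_decomposition[OF subset_refl sym] derangement_action_familyI
      pair_bidirected_digraph_axioms assms by metis
qed

lemma odd_regular_in_family:
  assumes "parcs G \<noteq> {}" and "regular_of_valency G k" and "odd k"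
    and f: "matching (parcs G) f" and free: "\<And>x. x \<in> pverts G \<Longrightarrow> f x \<noteq> x"
  shows "G \<in> derangement_action_family"
proof -
  let ?X = "pverts G"
  obtain r where k: "k = Suc (2 * r)"
    using assms(3) by (metis oddE Suc_eq_plus1)
  have f': "f (f x) = x" "f x \<noteq> x \<Longrightarrow> (x, f x) \<in> parcs G" for x
    using f by (auto simp: matching_def)
  have f_perm: "f permutes ?X"
    using f' wellformed' by (intro involution_permutes) blast+
  have f_arc: "(x, f x) \<in> parcs G" "f x \<in> ?X" if "x \<in> ?X" for x
    using f'(2) free that wellformed' by blast+
  have f_inv: "inv f = f"
    using f'(1) by (intro inv_unique_comp) auto
  \<comment> \<open>The arcs off the matching. They form a symmetric relation because
    \<open>f\<close> is an involution, and every degree drops to \<open>2 * r\<close>; the even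
    decomposition is stated for subrelations of \<open>parcs G\<close> so that it covers this
    case.\<close>
  define A where "A = parcs G - {(x, f x) | x. x \<in> ?X}"
  have "sym A"
  proof (rule symI)
    fix x y assume "(x, y) \<in> A"
    then show "(y, x) \<in> A"
      using sym f'(1) wellformed' unfolding A_def by (auto dest: symD)
  qed
  have card_A: "card (A `` {x}) = 2 * r" if "x \<in> ?X" for x
  proof -
    have "A `` {x} = parcs G `` {x} - {f x}"
      using that by (auto simp: A_def)
    then show ?thesis
      using that assms(2) k f_arc by (simp add: regular_of_valency_iff)
  qed
  have "A \<subseteq> parcs G"
    by (auto simp: A_def)
  from even_regular_decomposition[OF this \<open>sym A\<close> card_A]
  obtain S where "permutation_decomposition ?X A S" and S_inv: "\<And>s. s \<in> S \<Longrightarrow> inv s \<in> S"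
    by blast
  then have S: "\<And>s. s \<in> S \<Longrightarrow> s permutes ?X" "A = {(x, s x) | x s. x \<in> ?X \<and> s \<in> S}"
    "\<And>s t x. s \<in> S \<Longrightarrow> t \<in> S \<Longrightarrow> x \<in> ?X \<Longrightarrow> s x = t x \<Longrightarrow> s = t"
    unfolding permutation_decomposition_def by blast+
  have sep: "s x \<noteq> f x" if "s \<in> S" "x \<in> ?X" for s x
  proof -
    have "(x, s x) \<in> A"
      using that S(2) by blast
    then show ?thesis
      using that by (auto simp: A_def)
  qed
  show ?thesis
  proof (rule derangement_action_familyI[of G k "insert f S"])
    have "parcs G = A \<union> {(x, f x) | x. x \<in> ?X}"
      using f_arc by (auto simp: A_def)
    then have "parcs G = {(x, s x) | x s. x \<in> ?X \<and> s \<in> insert f S}"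
      unfolding S(2) by blast
    moreover have "s = t" if "s \<in> insert f S" "t \<in> insert f S" "x \<in> ?X" "s x = t x" for s t x
      using that S(3) sep by (metis insertE)
    moreover have "\<forall>s\<in>insert f S. s permutes ?X"
      using S(1) f_perm by simp
    ultimately show "permutation_decomposition ?X (parcs G) (insert f S)"
      unfolding permutation_decomposition_def by blast
    show "inv s \<in> insert f S" if "s \<in> insert f S" for s
      using that S_inv f_inv by auto
  qed (use assms pair_bidirected_digraph_axioms in auto)
qed

text \<open>The matching spans \<open>G\<close>, so every vertex lies in a component, which is a
  single edge; the involution sends the vertex to the other end.\<close>

lemma perfect_matching_involution:
  assumes M: "is_perfect_matching M G"
  obtains f where "matching (parcs G) f" and "\<And>x. x \<in> pverts G \<Longrightarrow> f x \<noteq> x"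
proof -
  interpret M: pair_sym_digraph M
    using M by (simp add: is_perfect_matching_def)
  have verts: "pverts M = pverts G" and arcs: "parcs M \<subseteq> parcs G"
    using M by (auto simp: is_perfect_matching_def spanning_def subgraph_def)
  have scc: "\<exists>y. x \<noteq> y \<and> M.scc_of x = {x, y} \<and> (x, y) \<in> parcs M" if "x \<in> pverts G" for x
  proof -
    have "with_proj M \<restriction> M.scc_of x \<in> M.sccs"
      using M.scc_of_in_sccs_verts M.in_verts_sccsD_sccs that verts by blast
    then have "is_single_edge (with_proj M \<restriction> M.scc_of x)"
      using M by (auto simp: is_perfect_matching_def)
    then obtain u v where uv: "u \<noteq> v" "M.scc_of x = {u, v}" "(u, v) \<in> parcs M" "(v, u) \<in> parcs M"
      by (auto simp: is_single_edge_def)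
    moreover have "x \<in> M.scc_of x"
      using M.in_scc_of_self that verts by simp
    ultimately show ?thesis
      by auto
  qed
  then obtain p where p: "\<And>x. x \<in> pverts G \<Longrightarrow> x \<noteq> p x \<and> M.scc_of x = {x, p x} \<and> (x, p x) \<in> parcs M"
    by metis
  have p_verts: "p x \<in> pverts G" if "x \<in> pverts G" for x
    using p[OF that] M.wellformed' verts by auto
  have "p (p x) = x" if x: "x \<in> pverts G" for x
  proof -
    \<comment> \<open>Mutual reachability is symmetric, so \<open>x\<close> lies in the component
      \<open>{p x, p (p x)}\<close>, and \<open>x\<close> differs from \<open>p x\<close>.\<close>
    have "p x \<in> M.scc_of x"
      using p[OF x] by simp
    then have "x \<in> M.scc_of (p x)"
      using M.in_scc_of_self by (simp add: M.scc_of_def)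
    then show ?thesis
      using p[OF x] p[OF p_verts[OF x]] by auto
  qed
  then have "matching (parcs G) (\<lambda>x. if x \<in> pverts G then p x else x)"
    using p p_verts arcs by (auto simp: matching_def)
  then show ?thesis
  proof (rule that)
    show "(if x \<in> pverts G then p x else x) \<noteq> x" if "x \<in> pverts G" for x
      using p[OF that] that by auto
  qed
qed

section \<open>Vertex-transitive and regular bipartite graphs\<close>

lemma vertex_transitive_permutation:
  assumes "vertex_transitive G" and "x \<in> pverts G" and "y \<in> pverts G"
  shows "\<exists>p. p permutes pverts G \<and> p x = y \<and> (\<forall>(a, b)\<in>parcs G. (p a, p b) \<in> parcs G)"
proof -
  obtain p where p: "p \<in> graph_automorphisms G" "p x = y"
    using assms unfolding vertex_transitive_def by blast
  then have "(p a, p b) \<in> parcs G" if "(a, b) \<in> parcs G" for a b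
    using that arcD[OF that] by (simp add: graph_automorphisms_def)
  then show ?thesis
    using p by (intro exI[of _ p]) (auto simp: graph_automorphisms_def)
qed

text \<open>An automorphism from \<open>x\<close> to \<open>y\<close> embeds the neighbourhood of
  \<open>x\<close> in that of \<open>y\<close>; exchanging the roles gives equal degrees.\<close>

lemma vertex_transitive_regular:
  assumes "vertex_transitive G"
  shows "\<exists>k. regular_of_valency G k"
proof -
  have le: "card (parcs G `` {x}) \<le> card (parcs G `` {y})" if xy: "x \<in> pverts G" "y \<in> pverts G" for x y
  proof -
    obtain p where p: "p permutes pverts G" "p x = y" "\<And>a b. (a, b) \<in> parcs G \<Longrightarrow> (p a, p b) \<in> parcs G"
      using vertex_transitive_permutation[OF assms xy] by auto
    have "p ` (parcs G `` {x}) \<subseteq> parcs G `` {y}"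
      using p(2,3) by auto
    then show ?thesis
      using permutes_inj_on[OF p(1)] pair_finite_arcs by (metis card_inj_on_le finite_Image)
  qed
  show ?thesis
  proof (cases "pverts G = {}")
    case False
    then obtain x where "x \<in> pverts G"
      by blast
    then have "regular_of_valency G (card (parcs G `` {x}))"
      using le by (auto simp: regular_of_valency_iff intro: antisym)
    then show ?thesis ..
  qed (simp add: regular_of_valency_iff)
qed

lemma vertex_transitive_in_family:
  assumes "parcs G \<noteq> {}" and "vertex_transitive G"
  shows "G \<in> derangement_action_family"
proof -
  obtain k where k: "regular_of_valency G k"
    using vertex_transitive_regular[OF assms(2)] ..
  show ?thesis
  proof (cases "even k")
    case False
    obtain f where "matching (parcs G) f" "\<And>x. x \<in> pverts G \<Longrightarrow> f x \<noteq> x"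
    proof (rule odd_regular_transitive_perfect_matching)
      show "card (parcs G `` {x}) = k" if "x \<in> pverts G" for x
        using k that by (simp add: regular_of_valency_iff)
    qed (use False vertex_transitive_permutation[OF assms(2)] in \<open>assumption | blast\<close>)+
    then show ?thesis
      using odd_regular_in_family assms(1) k False by blast
  qed (use even_regular_in_family assms(1) k in blast)
qed

lemma regular_bipartite_in_family:
  assumes "parcs G \<noteq> {}" and reg: "regular_of_valency G k" and "bipartite G"
  shows "G \<in> derangement_action_family"
proof (cases "even k")
  case False
  obtain U V where UV: "pverts G = U \<union> V" "U \<inter> V = {}" "parcs G \<subseteq> U \<times> V \<union> V \<times> U"
    using assms(3) by (auto simp: bipartite_def)
  have "k > 0"
    using False by (rule odd_pos)
  then obtain s where s: "s permutes pverts G" "\<And>x. x \<in> pverts G \<Longrightarrow> (x, s x) \<in> parcs G"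
    using regular_relation_permutation[OF finite_X subset, of k] reg
    by (metis arcs_sym regular_of_valency_iff)
  have inv: "inv s (s x) = x" "s (inv s x) = x" for x
    using permutes_inverses[OF s(1)] by auto
  have swap: "s x \<in> V \<longleftrightarrow> x \<in> U" "s x \<in> U \<longleftrightarrow> x \<in> V" if "x \<in> pverts G" for x
    using s(2)[OF that] UV(2,3) by auto
  have inv_verts: "inv s x \<in> pverts G" if "x \<in> pverts G" for x
    using permutes_in_image[OF permutes_inv[OF s(1)]] that by simp
  have swap_inv: "inv s x \<in> U \<longleftrightarrow> x \<in> V" if "x \<in> pverts G" for x
    using swap(1)[OF inv_verts[OF that]] inv(2) by simp
  have inv_arc: "(x, inv s x) \<in> parcs G" if "x \<in> pverts G" for x
    using arcD[OF s(2)[OF inv_verts[OF that]]] inv(2) by simp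
  \<comment> \<open>The permutation \<open>s\<close> runs along arcs and so exchanges the two sides.
    Following it from \<open>U\<close> and going back along it from \<open>V\<close> gives an
    involution, the matching with edges from \<open>u\<close> in \<open>U\<close> to
    \<open>s u\<close>.\<close>
  define f where "f x = (if x \<in> U then s x else if x \<in> V then inv s x else x)" for x
  have "f (f x) = x" for x
    using swap swap_inv inv UV(1,2) by (auto simp: f_def)
  moreover have "(x, f x) \<in> parcs G" if "x \<in> pverts G" for x
    using s(2)[OF that] inv_arc[OF that] that UV(1) by (auto simp: f_def)
  moreover have "f x = x" if "x \<notin> pverts G" for x
    using that UV(1) by (simp add: f_def)
  ultimately have "matching (parcs G) f" "\<And>x. x \<in> pverts G \<Longrightarrow> f x \<noteq> x"
    unfolding matching_def using arcD by metis+
  then show ?thesis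
    using odd_regular_in_family assms(1) reg False by blast
qed (use even_regular_in_family assms in blast)

end

theorem theorem1p10:
  fixes G :: "'a pair_pre_digraph"
  assumes "pair_graph G" and "parcs G \<noteq> {}"
  shows "(\<forall>k. regular_of_valency G k \<and> even k \<longrightarrow> G \<in> derangement_action_family) \<and>
         (\<forall>k. regular_of_valency G k \<and> odd k \<and> (\<exists>M. is_perfect_matching M G)
            \<longrightarrow> G \<in> derangement_action_family) \<and>
         (vertex_transitive G \<longrightarrow> G \<in> derangement_action_family) \<and>
         ((\<exists>k. regular_of_valency G k) \<and> bipartite G \<longrightarrow> G \<in> derangement_action_family)"
proof (intro conjI allI impI; (elim conjE exE)?)
  show "G \<in> derangement_action_family" if "regular_of_valency G k" "even k" for k
    using even_regular_in_family assms that by blast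
  show "G \<in> derangement_action_family"
    if "regular_of_valency G k" "odd k" "is_perfect_matching M G" for k M
    by (rule perfect_matching_involution[OF assms(1) that(3)])
      (rule odd_regular_in_family[OF assms that(1,2)])
  show "G \<in> derangement_action_family" if "vertex_transitive G"
    using vertex_transitive_in_family assms that by blast
  show "G \<in> derangement_action_family" if "regular_of_valency G k" "bipartite G" for k
    using regular_bipartite_in_family assms that by blast
qed

end
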